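(* Let $(\mathfrak g,[\cdot,\cdot,\cdot]_{\mathfrak g})$ be a $3$-Lie algebra and $(V;\rho)$ a representation of $\mathfrak g$. A linear map $T:V\to\mathfrak g$ is an embedding tensor on the $3$-Lie algebra $\mathfrak g$ with respect to the representation $(V;\rho)$ if and only if the graph $Gr(T)=\{Tu+u\mid u\in V\}$ is a $3$-Leibniz subalgebra of the hemisemidirect product $3$-Leibniz algebra $\mathfrak g\ltimes_\rho V$.
   Context: All vector spaces are over an algebraically closed field $\mathbb K$ of characteristic $0$. A $3$-Lie algebra is a vector space $\mathfrak g$ with a skew-symmetric trilinear bracket $[\cdot,\cdot,\cdot]_{\mathfrak g}$ such that $[x_1,x_2,[x_3,x_4,x_5]_{\mathfrak g}]_{\mathfrak g}=[[x_1,x_2,x_3]_{\mathfrak g},x_4,x_5]_{\mathfrak g}+[x_3,[x_1,x_2,x_4]_{\mathfrak g},x_5]_{\mathfrak g}+[x_3,x_4,[x_1,x_2,x_5]_{\mathfrak g}]_{\mathfrak g}$ for all $x_i\in\mathfrak g$. A representation of $\mathfrak g$ on a vector space $V$ is a linear map $\rho:\wedge^2\mathfrak g\to\mathfrak{gl}(V)$ such that for all $x_i\in\mathfrak g$: $\rho(x_1,x_2)\rho(x_3,x_4)=\rho([x_1,x_2,x_3]_{\mathfrak g},x_4)+\rho(x_3,[x_1,x_2,x_4]_{\mathfrak g})+\rho(x_3,x_4)\rho(x_1,x_2)$ and $\rho(x_1,[x_2,x_3,x_4]_{\mathfrak g})=\rho(x_3,x_4)\rho(x_1,x_2)-\rho(x_2,x_4)\rho(x_1,x_3)+\rho(x_2,x_3)\rho(x_1,x_4)$.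 An embedding tensor on $\mathfrak g$ with respect to $(V;\rho)$ is a linear map $T:V\to\mathfrak g$ with $[Tu,Tv,Tw]_{\mathfrak g}=T(\rho(Tu,Tv)w)$ for all $u,v,w\in V$. A $3$-Leibniz algebra is a vector space $\mathcal L$ with a trilinear bracket satisfying $[x_1,x_2,[y_1,y_2,y_3]]=[[x_1,x_2,y_1],y_2,y_3]+[y_1,[x_1,x_2,y_2],y_3]+[y_1,y_2,[x_1,x_2,y_3]]$ for all elements; a subalgebra is a linear subspace closed under the bracket. The hemisemidirect product $3$-Leibniz algebra $\mathfrak g\ltimes_\rho V$ is $\mathfrak g\oplus V$ with the bracket $[x+u,y+v,z+w]_\rho=[x,y,z]_{\mathfrak g}+\rho(x,y)w$ for $x,y,z\in\mathfrak g$, $u,v,w\in V$. *)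

theory Defs
  imports
    "HOL-Computational_Algebra.Polynomial"
    "HOL-Analysis.Product_Vector"
begin

definition trilinear ::
  "('k::field \<Rightarrow> 'a::ab_group_add \<Rightarrow> 'a) \<Rightarrow> ('k \<Rightarrow> 'b::ab_group_add \<Rightarrow> 'b) \<Rightarrow>
   ('k \<Rightarrow> 'c::ab_group_add \<Rightarrow> 'c) \<Rightarrow> ('k \<Rightarrow> 'd::ab_group_add \<Rightarrow> 'd) \<Rightarrow>
   ('a \<Rightarrow> 'b \<Rightarrow> 'c \<Rightarrow> 'd) \<Rightarrow> bool"
  where "trilinear s1 s2 s3 s4 f \<longleftrightarrow>
    (\<forall>y z. Vector_Spaces.linear s1 s4 (\<lambda>x. f x y z)) \<and>
    (\<forall>x z. Vector_Spaces.linear s2 s4 (\<lambda>y. f x y z)) \<and>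
    (\<forall>x y. Vector_Spaces.linear s3 s4 (\<lambda>z. f x y z))"

lemma trilinearD:
  assumes "trilinear s1 s2 s3 s4 f"
  shows "f (x + x') y z = f x y z + f x' y z" "f (s1 c x) y z = s4 c (f x y z)"
    "f x (y + y') z = f x y z + f x y' z" "f x (s2 c y) z = s4 c (f x y z)"
    "f x y (z + z') = f x y z + f x y z'" "f x y (s3 c z) = s4 c (f x y z)"
proof -
  have *: "Vector_Spaces.linear s1 s4 (\<lambda>x. f x y z)" "Vector_Spaces.linear s2 s4 (\<lambda>y. f x y z)"
    "Vector_Spaces.linear s3 s4 (\<lambda>z. f x y z)" for x y z
    using assms by (simp_all add: trilinear_def)
  note add = module_hom.add[OF module_hom_linearI] and scale = module_hom.scale[OF module_hom_linearI]
  show "f (x + x') y z = f x y z + f x' y z" by (rule add[OF *(1)])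
  show "f (s1 c x) y z = s4 c (f x y z)" by (rule scale[OF *(1)])
  show "f x (y + y') z = f x y z + f x y' z" by (rule add[OF *(2)])
  show "f x (s2 c y) z = s4 c (f x y z)" by (rule scale[OF *(2)])
  show "f x y (z + z') = f x y z + f x y z'" by (rule add[OF *(3)])
  show "f x y (s3 c z) = s4 c (f x y z)" by (rule scale[OF *(3)])
qed

locale three_lie_algebra = g: vector_space sg
  for sg :: "'k::{alg_closed_field, field_char_0} \<Rightarrow> 'g::ab_group_add \<Rightarrow> 'g" +
  fixes br :: "'g \<Rightarrow> 'g \<Rightarrow> 'g \<Rightarrow> 'g"
  assumes br_trilinear: "trilinear sg sg sg sg br"
    and br_skew_12: "br x y z = - br y x z"
    and br_skew_23: "br x y z = - br x z y"
    and br_fundamental: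
      "br x1 x2 (br x3 x4 x5) =
         br (br x1 x2 x3) x4 x5 + br x3 (br x1 x2 x4) x5 + br x3 x4 (br x1 x2 x5)"

text \<open>
  A linear map from the exterior square of the 3-Lie algebra to the endomorphisms of \<open>V\<close> is
  encoded, by the universal property, as a curried alternating bilinear map. Linearity of
  \<open>\<rho> x y\<close> as an endomorphism and bilinearity of \<open>\<rho>\<close> in \<open>(x, y)\<close> together say that
  \<open>\<rho> x y v\<close> is trilinear in \<open>(x, y, v)\<close>.
\<close>

locale three_lie_representation =
  three_lie_algebra sg br + V: vector_space sv
  for sg :: "'k::{alg_closed_field, field_char_0} \<Rightarrow> 'g::ab_group_add \<Rightarrow> 'g"
    and br :: "'g \<Rightarrow> 'g \<Rightarrow> 'g \<Rightarrow> 'g"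
    and sv :: "'k \<Rightarrow> 'v::ab_group_add \<Rightarrow> 'v" +
  fixes \<rho> :: "'g \<Rightarrow> 'g \<Rightarrow> 'v \<Rightarrow> 'v"
  assumes rho_trilinear: "trilinear sg sg sv sv \<rho>"
    and rho_alternating: "\<rho> x x v = 0"
    and rho_fundamental:
      "\<rho> x1 x2 (\<rho> x3 x4 v) =
         \<rho> (br x1 x2 x3) x4 v + \<rho> x3 (br x1 x2 x4) v + \<rho> x3 x4 (\<rho> x1 x2 v)"
    and rho_bracket:
      "\<rho> x1 (br x2 x3 x4) v =
         \<rho> x3 x4 (\<rho> x1 x2 v) - \<rho> x2 x4 (\<rho> x1 x3 v) + \<rho> x2 x3 (\<rho> x1 x4 v)"

locale embedding_tensor =
  three_lie_representation sg br sv \<rho>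
  for sg :: "'k::{alg_closed_field, field_char_0} \<Rightarrow> 'g::ab_group_add \<Rightarrow> 'g"
    and br :: "'g \<Rightarrow> 'g \<Rightarrow> 'g \<Rightarrow> 'g"
    and sv :: "'k \<Rightarrow> 'v::ab_group_add \<Rightarrow> 'v"
    and \<rho> :: "'g \<Rightarrow> 'g \<Rightarrow> 'v \<Rightarrow> 'v" +
  fixes T :: "'v \<Rightarrow> 'g"
  assumes T_linear: "Vector_Spaces.linear sv sg T"
    and T_embedding: "br (T u) (T v) (T w) = T (\<rho> (T u) (T v) w)"

locale three_leibniz_algebra = L: vector_space sl
  for sl :: "'k::{alg_closed_field, field_char_0} \<Rightarrow> 'l::ab_group_add \<Rightarrow> 'l" +
  fixes lb :: "'l \<Rightarrow> 'l \<Rightarrow> 'l \<Rightarrow> 'l"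
  assumes lb_trilinear: "trilinear sl sl sl sl lb"
    and lb_fundamental:
      "lb x1 x2 (lb y1 y2 y3) =
         lb (lb x1 x2 y1) y2 y3 + lb y1 (lb x1 x2 y2) y3 + lb y1 y2 (lb x1 x2 y3)"

locale three_leibniz_subalgebra = three_leibniz_algebra sl lb
  for sl :: "'k::{alg_closed_field, field_char_0} \<Rightarrow> 'l::ab_group_add \<Rightarrow> 'l"
    and lb :: "'l \<Rightarrow> 'l \<Rightarrow> 'l \<Rightarrow> 'l" +
  fixes S :: "'l set"
  assumes sub_subspace: "L.subspace S"
    and sub_closed: "\<lbrakk>x \<in> S; y \<in> S; z \<in> S\<rbrakk> \<Longrightarrow> lb x y z \<in> S"

text \<open>
  The direct sum of the 3-Lie algebra and \<open>V\<close> is the product type with the scalar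
  multiplication \<open>module_prod.scale\<close>; an element \<open>x + u\<close> is the pair \<open>(x, u)\<close>.
\<close>

definition hemisemidirect_bracket ::
  "('g \<Rightarrow> 'g \<Rightarrow> 'g \<Rightarrow> 'g) \<Rightarrow> ('g \<Rightarrow> 'g \<Rightarrow> 'v \<Rightarrow> 'v) \<Rightarrow>
   'g \<times> 'v \<Rightarrow> 'g \<times> 'v \<Rightarrow> 'g \<times> 'v \<Rightarrow> 'g \<times> 'v"
  where "hemisemidirect_bracket br \<rho> p q r =
    (br (fst p) (fst q) (fst r), \<rho> (fst p) (fst q) (snd r))"

definition map_graph :: "('v \<Rightarrow> 'g) \<Rightarrow> ('g \<times> 'v) set"
  where "map_graph T = {(T u, u) | u. True}"

context three_lie_representation
begin

lemma hemisemidirect_three_leibniz_algebra: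
  "three_leibniz_algebra (module_prod.scale sg sv) (hemisemidirect_bracket br \<rho>)"
proof -
  interpret P: vector_space_prod sg sv ..
  have vs: "vector_space P.scale" ..
  have lin: "Vector_Spaces.linear P.scale P.scale f"
    if "\<And>p q. f (p + q) = f p + f q" "\<And>c p. f (P.scale c p) = P.scale c (f p)" for f
    using that vs
    by (intro linear_module_homI module_hom.intro module_hom_axioms.intro)
      (simp_all only: module_iff_vector_space)
  have B':
    "br (x + x') y z = br x y z + br x' y z" "br (sg c x) y z = sg c (br x y z)"
    "br x (y + y') z = br x y z + br x y' z" "br x (sg c y) z = sg c (br x y z)"
    "br x y (z + z') = br x y z + br x y z'" "br x y (sg c z) = sg c (br x y z)"
    for x x' y y' z z' c
    by (rule trilinearD[OF br_trilinear])+
  have R':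
    "\<rho> (x + x') y v = \<rho> x y v + \<rho> x' y v" "\<rho> (sg c x) y v = sv c (\<rho> x y v)"
    "\<rho> x (y + y') v = \<rho> x y v + \<rho> x y' v" "\<rho> x (sg c y) v = sv c (\<rho> x y v)"
    "\<rho> x y (v + v') = \<rho> x y v + \<rho> x y v'" "\<rho> x y (sv c v) = sv c (\<rho> x y v)"
    for x x' y y' v v' c
    by (rule trilinearD[OF rho_trilinear])+
  show ?thesis
  proof (intro three_leibniz_algebra.intro three_leibniz_algebra_axioms.intro vs)
    show "trilinear P.scale P.scale P.scale P.scale (hemisemidirect_bracket br \<rho>)"
      unfolding trilinear_def
      by (intro conjI allI lin) (simp_all add: hemisemidirect_bracket_def P.scale_def B' R')
    show "hemisemidirect_bracket br \<rho> x1 x2 (hemisemidirect_bracket br \<rho> y1 y2 y3) =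
        hemisemidirect_bracket br \<rho> (hemisemidirect_bracket br \<rho> x1 x2 y1) y2 y3 +
        hemisemidirect_bracket br \<rho> y1 (hemisemidirect_bracket br \<rho> x1 x2 y2) y3 +
        hemisemidirect_bracket br \<rho> y1 y2 (hemisemidirect_bracket br \<rho> x1 x2 y3)"
      for x1 x2 y1 y2 y3
      by (rule prod_eqI)
        (simp_all only: hemisemidirect_bracket_def fst_conv snd_conv fst_add snd_add
          br_fundamental[of "fst x1"] rho_fundamental[of "fst x1"])
  qed
qed

end

end

theory Submission
  imports Defs
begin

text \<open>
  The bracket of three graph elements \<open>(T u, u)\<close>, \<open>(T v, v)\<close>, \<open>(T w, w)\<close> in the hemisemidirect
  product is \<open>([T u, T v, T w], \<rho> (T u) (T v) w)\<close>. Since a graph has exactly one point over each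
  second component, this pair lies in the graph precisely when its first component is the
  \<open>T\<close>-image of its second one, which is the embedding tensor identity. The remaining requirement
  on a subalgebra, being a linear subspace, is automatic for the graph of a linear map.
\<close>

lemma mem_map_graph_iff: "p \<in> map_graph T \<longleftrightarrow> fst p = T (snd p)"
  by (cases p) (auto simp: map_graph_def)

lemma subspace_map_graph:
  assumes "Vector_Spaces.linear sv sg T"
  shows "module.subspace (module_prod.scale sg sv) (map_graph T)"
proof -
  interpret T: Vector_Spaces.linear sv sg T by (fact assms)
  interpret P: vector_space_prod sg sv ..
  show ?thesis
    by (rule P.p.subspaceI) (simp_all add: mem_map_graph_iff P.scale_def T.zero T.add T.scale)
qed

lemma map_graph_closed_iff:
  "(\<forall>p \<in> map_graph T. \<forall>q \<in> map_graph T. \<forall>r \<in> map_graph T.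
      hemisemidirect_bracket br \<rho> p q r \<in> map_graph T) \<longleftrightarrow>
    (\<forall>u v w. br (T u) (T v) (T w) = T (\<rho> (T u) (T v) w))"
  by (auto simp: map_graph_def hemisemidirect_bracket_def)

theorem theorem2p6:
  fixes sg :: "'k::{alg_closed_field, field_char_0} \<Rightarrow> 'g::ab_group_add \<Rightarrow> 'g"
    and br :: "'g \<Rightarrow> 'g \<Rightarrow> 'g \<Rightarrow> 'g"
    and sv :: "'k \<Rightarrow> 'v::ab_group_add \<Rightarrow> 'v"
    and \<rho> :: "'g \<Rightarrow> 'g \<Rightarrow> 'v \<Rightarrow> 'v"
    and T :: "'v \<Rightarrow> 'g"
  assumes "three_lie_algebra sg br"
    and "three_lie_representation sg br sv \<rho>"
    and "Vector_Spaces.linear sv sg T"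
  shows "embedding_tensor sg br sv \<rho> T \<longleftrightarrow>
    three_leibniz_subalgebra (module_prod.scale sg sv) (hemisemidirect_bracket br \<rho>) (map_graph T)"
proof -
  interpret three_lie_representation sg br sv \<rho> by (fact assms(2))
  interpret H: three_leibniz_algebra "module_prod.scale sg sv" "hemisemidirect_bracket br \<rho>"
    by (fact hemisemidirect_three_leibniz_algebra)
  have "embedding_tensor sg br sv \<rho> T \<longleftrightarrow>
      (\<forall>u v w. br (T u) (T v) (T w) = T (\<rho> (T u) (T v) w))"
    using assms(2,3) by (simp add: embedding_tensor_def embedding_tensor_axioms_def)
  also have "\<dots> \<longleftrightarrow> (\<forall>p \<in> map_graph T. \<forall>q \<in> map_graph T. \<forall>r \<in> map_graph T.
      hemisemidirect_bracket br \<rho> p q r \<in> map_graph T)"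
    by (simp only: map_graph_closed_iff)
  also have "\<dots> \<longleftrightarrow> three_leibniz_subalgebra (module_prod.scale sg sv)
      (hemisemidirect_bracket br \<rho>) (map_graph T)"
    using subspace_map_graph[OF assms(3)] H.three_leibniz_algebra_axioms
    unfolding three_leibniz_subalgebra_def three_leibniz_subalgebra_axioms_def by blast
  finally show ?thesis .
qed

end
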